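(* Let $n,t,\delta$ be integers with $n\ge 3$ and $3\le t+1\le \delta\le \left\lfloor \frac{n+t-2}{2}\right\rfloor$, let $\alpha\in[0,1)$, and let $h=\left\lfloor \frac{n+t-2}{2}\right\rfloor$. Put $$f_1(n,t,\delta,2)=\binom{n+t-\delta-1}{2}+(\delta-t+1)\delta,\qquad g_1(n,t,\delta,2)=\binom{n+t-h-1}{2}+(h-t)h+\delta,$$ and $h_1=\max\{f_1(n,t,\delta,2),\,g_1(n,t,\delta,2)\}$. Let $G$ be a finite, simple, connected graph of order $n$ with minimum degree $\delta$. If $$\lambda_\alpha(G)>\frac{\delta+\alpha n-\alpha\delta-1+\sqrt{(\delta+\alpha n-\alpha\delta-1)^2+4(1-\alpha)(2h_1-n\delta+\delta)}}{2},$$ then $G$ is one-to-many $t$-disjoint path coverable.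
   Context: The order of a graph is its number of vertices. For $\alpha\in[0,1)$, $A_\alpha(G)=\alpha D(G)+(1-\alpha)A(G)$, where $A(G)$ is the adjacency matrix and $D(G)$ the diagonal matrix of vertex degrees of $G$; the $\alpha$-spectral radius $\lambda_\alpha(G)$ is the largest eigenvalue of $A_\alpha(G)$. A graph $G$ is one-to-many $t$-disjoint path coverable if for any vertex $u$ and any set $\{v_1,\dots,v_t\}$ of $t$ distinct vertices of $G$ not containing $u$, there exist $t$ paths $P_1,\dots,P_t$ in $G$ such that $P_i$ joins $u$ and $v_i$, every vertex of $G$ lies on at least one of the paths, and any two of the paths have no common vertex other than $u$. *)

theory Defs
  imports
    "HOL-Analysis.Analysis"
    "Jordan_Normal_Form.Spectral_Radius"
    "Graph_Theory.Graph_Theory"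
begin

text \<open>
  A finite simple graph is a \<^locale>\<open>pair_graph\<close>: a finite set of vertices with a symmetric,
  irreflexive set of arcs, each edge being represented by its two opposite arcs. In
  particular the degree of a vertex is its \<^const>\<open>out_degree\<close>.
\<close>

definition min_degree :: "'a pair_pre_digraph \<Rightarrow> nat" where
  "min_degree G = Min (out_degree (with_proj G) ` pverts G)"

text \<open>Rows and columns are indexed by positions in an enumeration \<open>vs\<close> of the vertices.\<close>

definition adjacency_matrix :: "'a pair_pre_digraph \<Rightarrow> 'a list \<Rightarrow> real mat" where
  "adjacency_matrix G vs =
     mat (length vs) (length vs) (\<lambda>(i, j). if (vs ! i, vs ! j) \<in> parcs G then 1 else 0)"

definition degree_matrix :: "'a pair_pre_digraph \<Rightarrow> 'a list \<Rightarrow> real mat" where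
  "degree_matrix G vs = mat_diag (length vs) (\<lambda>i. real (out_degree (with_proj G) (vs ! i)))"

definition A_alpha :: "real \<Rightarrow> 'a pair_pre_digraph \<Rightarrow> 'a list \<Rightarrow> real mat" where
  "A_alpha \<alpha> G vs = \<alpha> \<cdot>\<^sub>m degree_matrix G vs + (1 - \<alpha>) \<cdot>\<^sub>m adjacency_matrix G vs"

text \<open>
  Reordering the vertices conjugates the matrix by a permutation matrix, so the choice of the
  enumeration does not affect the spectrum. The matrix is real symmetric, so its real
  spectrum contains all its eigenvalues and, for a nonempty graph, is finite and nonempty.
\<close>

definition alpha_spectral_radius :: "real \<Rightarrow> 'a pair_pre_digraph \<Rightarrow> real" where
  "alpha_spectral_radius \<alpha> G =
     Max (spectrum (A_alpha \<alpha> G (SOME vs. distinct vs \<and> set vs = pverts G)))"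

text \<open>The \<open>t\<close> paths are indexed by their endpoints \<open>v \<in> S\<close>.\<close>

definition one_to_many_disjoint_path_coverable :: "nat \<Rightarrow> 'a pair_pre_digraph \<Rightarrow> bool" where
  "one_to_many_disjoint_path_coverable t G \<longleftrightarrow>
     (\<forall>u \<in> pverts G. \<forall>S. S \<subseteq> pverts G - {u} \<and> card S = t \<longrightarrow>
       (\<exists>P. (\<forall>v \<in> S. vpath (P v) (with_proj G) \<and> hd (P v) = u \<and> last (P v) = v) \<and>
            (\<forall>w \<in> pverts G. \<exists>v \<in> S. w \<in> set (P v)) \<and>
            (\<forall>v \<in> S. \<forall>v' \<in> S. v \<noteq> v' \<longrightarrow> set (P v) \<inter> set (P v') \<subseteq> {u})))"

text \<open>
  These are \<open>f\<^sub>1(n, t, \<delta>, 2)\<close> and, with \<open>h = \<lfloor>(n + t - 2) / 2\<rfloor>\<close>, \<open>g\<^sub>1(n, t, \<delta>, 2)\<close>. All the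
  subtractions on natural numbers are exact when \<open>2 \<le> t\<close> and \<open>t + 1 \<le> \<delta> \<le> h\<close>.
\<close>

definition edge_bound_f :: "nat \<Rightarrow> nat \<Rightarrow> nat \<Rightarrow> nat" where
  "edge_bound_f n t \<delta> = ((n + t - \<delta> - 1) choose 2) + (\<delta> - t + 1) * \<delta>"

definition edge_bound_g :: "nat \<Rightarrow> nat \<Rightarrow> nat \<Rightarrow> nat" where
  "edge_bound_g n t \<delta> =
     (let h = (n + t - 2) div 2 in ((n + t - h - 1) choose 2) + (h - t) * h + \<delta>)"

end

theory Submission
  imports Defs
begin

text \<open>
  Suppose that some \<open>u\<close> and \<open>S\<close> admit no covering by disjoint paths, and add edges to \<open>G\<close> as long
  as this remains so. In the saturated graph nonadjacent vertices have degree sum at most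
  \<open>n + t - 2\<close>, by a rotation argument. If \<open>x\<close>, \<open>y\<close> is a nonadjacent pair of maximal degree sum and
  \<open>k = d(x) \<le> d(y)\<close>, then at least \<open>k - t + 1\<close> nonneighbours of \<open>y\<close> have degree at most \<open>k\<close>, so
  that \<open>G\<close> has at most \<open>binom(n + t - k - 1, 2) + (k - t) k + \<delta>\<close> edges. This bound is convex in \<open>k\<close>, and
  its values at the ends \<open>k = \<delta>\<close> and \<open>k = h\<close> of the range are \<open>f\<^sub>1\<close> and \<open>g\<^sub>1\<close>.

  On the other hand, put \<open>c = \<delta> + \<alpha> n - \<alpha> \<delta> - 1\<close> and let \<open>m\<close> be the number of edges. The column
  sums of \<open>A\<^sub>\<alpha>\<^sup>2 - c A\<^sub>\<alpha>\<close> are at most \<open>R = (1 - \<alpha>) (2 m - n \<delta> + \<delta>)\<close>, whence \<open>\<lambda>\<^sup>2 - c \<lambda> \<le> R\<close>, and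
  a large \<open>\<lambda>\<close> forces \<open>m > h\<^sub>1\<close>.
\<close>

no_notation vec_nth (infixl "$" 90)

section \<open>Rotations of spanning spiders\<close>

text \<open>Each of the \<open>card (set L) - 1\<close> pairs of consecutive entries is charged at
  most once: by its left member if that lies in \<open>M\<close>, or by its right member if that
  lies in \<open>N\<close>. The last entry is never a left member and the first never a right
  member.\<close>

lemma card_crossing_free:
  assumes "distinct L" "L \<noteq> []"
    and "\<And>L1 L2. L = L1 @ L2 \<Longrightarrow> L1 \<noteq> [] \<Longrightarrow> L2 \<noteq> [] \<Longrightarrow> last L1 \<in> M \<Longrightarrow> hd L2 \<in> N \<Longrightarrow> False"
  shows "card (M \<inter> set L - {last L}) + card (N \<inter> set L - {hd L}) + 1 \<le> card (set L)"
  using assms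
proof (induction L)
  case (Cons a L)
  show ?case
  proof (cases L)
    case Nil
    then show ?thesis by simp
  next
    case (Cons b L')
    have IH: "card (M \<inter> set L - {last L}) + card (N \<inter> set L - {hd L}) + 1 \<le> card (set L)"
    proof (rule Cons.IH)
      fix L1 L2 assume "L = L1 @ L2" "L1 \<noteq> []" "L2 \<noteq> []" "last L1 \<in> M" "hd L2 \<in> N"
      then show False using Cons.prems(3)[of "a # L1" L2] by auto
    qed (use Cons.prems Cons in auto)
    have ab: "\<not> (a \<in> M \<and> b \<in> N)" using Cons.prems(3)[of "[a]" L] Cons by auto
    have a: "a \<notin> set L" "hd L = b" "b \<in> set L" "last (a # L) = last L" "last L \<in> set L"
      using Cons.prems(1) Cons by auto
    have M: "M \<inter> set (a # L) - {last (a # L)} =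
        (if a \<in> M then {a} else {}) \<union> (M \<inter> set L - {last L})"
      using a by auto
    have cM: "card (M \<inter> set (a # L) - {last (a # L)}) =
        (if a \<in> M then 1 else 0) + card (M \<inter> set L - {last L})"
      unfolding M using a by (subst card_Un_disjoint) auto
    have N: "N \<inter> set (a # L) - {hd (a # L)} =
        (if b \<in> N then {b} else {}) \<union> (N \<inter> set L - {hd L})"
      using a by auto
    have cN: "card (N \<inter> set (a # L) - {hd (a # L)}) =
        (if b \<in> N then 1 else 0) + card (N \<inter> set L - {hd L})"
      unfolding N using a by (subst card_Un_disjoint) auto
    have "card (set (a # L)) = Suc (card (set L))" using a by simp
    then show ?thesis using IH ab unfolding cM cN by (auto split: if_splits)
  qed
qed simp

text \<open>The legs are indexed by their feet \<open>v\<close> and are plain vertex lists over an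
  arbitrary relation, so that edges can be added without forming a new graph.\<close>

definition spanning_spider :: "'a set \<Rightarrow> 'a rel \<Rightarrow> 'a \<Rightarrow> 'a set \<Rightarrow> ('a \<Rightarrow> 'a list) \<Rightarrow> bool" where
  "spanning_spider V E u S P \<longleftrightarrow>
     (\<forall>v\<in>S. P v \<noteq> [] \<and> hd (P v) = u \<and> last (P v) = v \<and> distinct (P v) \<and>
            successively (\<lambda>a b. (a, b) \<in> E) (P v)) \<and>
     (\<forall>v\<in>S. \<forall>v'\<in>S. v \<noteq> v' \<longrightarrow> set (P v) \<inter> set (P v') \<subseteq> {u}) \<and>
     (\<Union>v\<in>S. set (P v)) = V"

lemma spanning_spiderD:
  assumes "spanning_spider V E u S P" "v \<in> S"
  shows "P v \<noteq> []" "hd (P v) = u" "last (P v) = v" "distinct (P v)"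
    "successively (\<lambda>a b. (a, b) \<in> E) (P v)" "u \<in> set (P v)" "v \<in> set (P v)" "set (P v) \<subseteq> V"
proof -
  show *: "P v \<noteq> []" "hd (P v) = u" "last (P v) = v" "distinct (P v)"
    "successively (\<lambda>a b. (a, b) \<in> E) (P v)" "set (P v) \<subseteq> V"
    using assms by (auto simp: spanning_spider_def)
  show "u \<in> set (P v)" using *(1,2) hd_in_set by blast
  show "v \<in> set (P v)" using *(1,3) last_in_set by metis
qed

lemma spanning_spider_disjoint:
  assumes "spanning_spider V E u S P" "v \<in> S" "v' \<in> S" "v \<noteq> v'"
  shows "set (P v) \<inter> set (P v') \<subseteq> {u}"
  using assms unfolding spanning_spider_def by blast

lemma spanning_spider_cover:
  assumes "spanning_spider V E u S P"
  shows "(\<Union>v\<in>S. set (P v)) = V"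
  using assms unfolding spanning_spider_def by blast

text \<open>Disjointness and covering depend only on the vertex sets of the legs, so a leg may be
  rerouted through the same vertices. The relation may change because the old spider can use an edge
  that the new one avoids.\<close>

lemma spanning_spider_update:
  assumes "spanning_spider V E u S P" "i \<in> S"
    and "\<And>v. v \<in> S \<Longrightarrow> v \<noteq> i \<Longrightarrow> successively (\<lambda>a b. (a, b) \<in> E') (P v)"
    and "successively (\<lambda>a b. (a, b) \<in> E') L" "distinct L" "L \<noteq> []" "hd L = u" "last L = i"
    and "set L = set (P i)"
  shows "spanning_spider V E' u S (P(i := L))"
proof -
  have "set ((P(i := L)) v) = set (P v)" for v using assms(9) by simp
  then show ?thesis using assms unfolding spanning_spider_def by auto
qed

text \<open>Two legs may exchange vertices as long as their union is kept: a third leg meets both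
  old legs only in \<open>u\<close>, hence also both new ones.\<close>

lemma spanning_spider_update2:
  assumes sp: "spanning_spider V E u S P" and ij: "i \<in> S" "j \<in> S" "i \<noteq> j"
    and succ: "\<And>v. v \<in> S \<Longrightarrow> v \<noteq> i \<Longrightarrow> v \<noteq> j \<Longrightarrow> successively (\<lambda>a b. (a, b) \<in> E') (P v)"
    and L: "successively (\<lambda>a b. (a, b) \<in> E') L" "distinct L" "L \<noteq> []" "hd L = u" "last L = i"
    and K: "successively (\<lambda>a b. (a, b) \<in> E') K" "distinct K" "K \<noteq> []" "hd K = u" "last K = j"
    and LK: "set L \<union> set K = set (P i) \<union> set (P j)" "set L \<inter> set K \<subseteq> {u}"
  shows "spanning_spider V E' u S (P(i := L, j := K))"
proof -
  have dis: "set (P v) \<inter> set L \<subseteq> {u}" "set (P v) \<inter> set K \<subseteq> {u}"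
    if "v \<in> S" "v \<noteq> i" "v \<noteq> j" for v
    using spanning_spider_disjoint[OF sp, of v i] spanning_spider_disjoint[OF sp, of v j] that ij LK(1)
    by blast+
  have "(\<Union>v\<in>S. set ((P(i := L, j := K)) v)) = (\<Union>v\<in>S-{i,j}. set (P v)) \<union> (set L \<union> set K)"
    using ij by (auto split: if_splits)
  also have "\<dots> = (\<Union>v\<in>S. set (P v))"
    unfolding LK(1) using ij by blast
  finally have "(\<Union>v\<in>S. set ((P(i := L, j := K)) v)) = V"
    using spanning_spider_cover[OF sp] by simp
  moreover have "\<forall>v\<in>S. \<forall>v'\<in>S. v \<noteq> v' \<longrightarrow>
      set ((P(i := L, j := K)) v) \<inter> set ((P(i := L, j := K)) v') \<subseteq> {u}"
    using dis LK(2) spanning_spider_disjoint[OF sp] by (auto split: if_splits)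
  moreover have "\<forall>v\<in>S. (P(i := L, j := K)) v \<noteq> [] \<and> hd ((P(i := L, j := K)) v) = u \<and>
      last ((P(i := L, j := K)) v) = v \<and> distinct ((P(i := L, j := K)) v) \<and>
      successively (\<lambda>a b. (a, b) \<in> E') ((P(i := L, j := K)) v)"
    using L K succ spanning_spiderD[OF sp] ij by auto
  ultimately show ?thesis unfolding spanning_spider_def by blast
qed

lemma successively_rev_sym:
  assumes "sym E" "successively (\<lambda>a b. (a, b) \<in> E) L"
  shows "successively (\<lambda>a b. (a, b) \<in> E) (rev L)"
  using assms by (auto elim!: successively_mono simp: sym_def)

text \<open>An edge \<open>xy\<close> of a spider can be exchanged for two others whenever \<open>x\<close> and \<open>y\<close> are
  suitably joined to two consecutive vertices of a leg, as in the closure lemma of Bondy and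
  Chvatal. On a leg other than the one containing \<open>xy\<close>, the exchange swaps the ends of the
  two legs.\<close>

lemma degree_sum_of_broken_spider:
  assumes E: "sym E" "E \<subseteq> V \<times> V" and fin: "finite V"
    and xy: "(x, y) \<notin> E" "(x, x) \<notin> E" "(y, y) \<notin> E"
    and S: "finite S" "card S \<ge> 2"
    and none: "\<And>P. \<not> spanning_spider V E u S P"
    and sp: "spanning_spider V E' u S P"
    and i: "i \<in> S" "P i = A @ B" "A \<noteq> []" "B \<noteq> []" "last A = x" "hd B = y"
    and A: "successively (\<lambda>a b. (a, b) \<in> E) A" and B: "successively (\<lambda>a b. (a, b) \<in> E) B"
    and others: "\<And>v. v \<in> S \<Longrightarrow> v \<noteq> i \<Longrightarrow> successively (\<lambda>a b. (a, b) \<in> E) (P v)"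
  shows "card (E `` {x}) + card (E `` {y}) + 2 \<le> card V + card S"
proof -
  let ?X = "E `` {x}" and ?Y = "E `` {y}"
  note D = spanning_spiderD[OF sp]
  have dAB: "distinct A" "distinct B" "set A \<inter> set B = {}"
    using D(4)[OF i(1)] i(2) by auto
  have hdA: "hd A = u" and lastB: "last B = i" using D(2,3)[OF i(1)] i by auto
  have uA: "u \<in> set A" using hdA i(3) by auto
  have finE: "finite (E `` Z)" for Z
    by (rule finite_subset[OF _ fin]) (use E in auto)
  have symE: "(b, a) \<in> E" if "(a, b) \<in> E" for a b using that E(1) by (auto simp: sym_def)
  \<comment> \<open>If consecutive vertices \<open>a\<close>, \<open>b\<close> of \<open>A\<close>
    are adjacent to \<open>x\<close> and \<open>y\<close> respectively, the path from
    \<open>u\<close> to \<open>a\<close>, across to \<open>x\<close>, back along \<open>A\<close> to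
    \<open>b\<close> and across to \<open>y\<close> avoids the edge \<open>xy\<close>.\<close>
  have cA: "card (?X \<inter> set A - {last A}) + card (?Y \<inter> set A - {hd A}) + 1 \<le> card (set A)"
  proof (rule card_crossing_free[OF dAB(1) i(3)])
    fix A1 A2 assume *: "A = A1 @ A2" "A1 \<noteq> []" "A2 \<noteq> []" "last A1 \<in> ?X" "hd A2 \<in> ?Y"
    have "spanning_spider V E u S (P(i := A1 @ rev A2 @ B))"
    proof (rule spanning_spider_update[OF sp i(1) others])
      show "successively (\<lambda>a b. (a, b) \<in> E) (A1 @ rev A2 @ B)"
        using A B * successively_rev_sym[OF E(1), of A2] i(4,5,6) symE
        by (auto simp: successively_append_iff hd_rev last_rev)
    qed (use * dAB i lastB hdA in auto)
    then show False using none by blast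
  qed
  \<comment> \<open>The mirror image: \<open>x\<close> is joined to the end of \<open>B1\<close>,
    which is run through backwards to \<open>y\<close>, and \<open>y\<close> is joined to the start
    of \<open>B2\<close>.\<close>
  have cB: "card (?X \<inter> set B - {last B}) + card (?Y \<inter> set B - {hd B}) + 1 \<le> card (set B)"
  proof (rule card_crossing_free[OF dAB(2) i(4)])
    fix B1 B2 assume *: "B = B1 @ B2" "B1 \<noteq> []" "B2 \<noteq> []" "last B1 \<in> ?X" "hd B2 \<in> ?Y"
    have "spanning_spider V E u S (P(i := A @ rev B1 @ B2))"
    proof (rule spanning_spider_update[OF sp i(1) others])
      show "successively (\<lambda>a b. (a, b) \<in> E) (A @ rev B1 @ B2)"
        using A B * successively_rev_sym[OF E(1), of B1] i(3,5,6) symE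
        by (auto simp: successively_append_iff hd_rev last_rev)
    qed (use * dAB i lastB hdA in auto)
    then show False using none by blast
  qed
  \<comment> \<open>On another leg the roles of \<open>?X\<close> and \<open>?Y\<close> are
    exchanged: \<open>C1\<close> is joined to \<open>y\<close> and continues with \<open>B\<close>,
    while \<open>A\<close> continues from \<open>x\<close> with \<open>C2\<close>. Both feet are
    kept.\<close>
  have cj: "card (?Y \<inter> set (P j) - {last (P j)}) + card (?X \<inter> set (P j) - {hd (P j)}) + 1
      \<le> card (set (P j))" if j: "j \<in> S" "j \<noteq> i" for j
  proof (rule card_crossing_free[OF D(4)[OF j(1)] D(1)[OF j(1)]])
    fix C1 C2 assume *: "P j = C1 @ C2" "C1 \<noteq> []" "C2 \<noteq> []" "last C1 \<in> ?Y" "hd C2 \<in> ?X"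
    have dC: "distinct C1" "distinct C2" "set C1 \<inter> set C2 = {}" using D(4)[OF j(1)] * by auto
    have hC: "hd C1 = u" "last C2 = j" using D(2,3)[OF j(1)] * by auto
    have dis: "(set A \<union> set B) \<inter> (set C1 \<union> set C2) \<subseteq> {u}"
      using spanning_spider_disjoint[OF sp i(1) j(1)] j(2) i(2) * by auto
    have uC: "u \<in> set C1" using hC(1) *(2) by auto
    have sC: "successively (\<lambda>a b. (a, b) \<in> E) C1" "successively (\<lambda>a b. (a, b) \<in> E) C2"
      using others[OF j] * by (auto simp: successively_append_iff)
    have "spanning_spider V E u S (P(i := C1 @ B, j := A @ C2))"
    proof (rule spanning_spider_update2[OF sp i(1) j(1) j(2)[symmetric] others])
      show "successively (\<lambda>a b. (a, b) \<in> E) (C1 @ B)" "successively (\<lambda>a b. (a, b) \<in> E) (A @ C2)"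
        using sC A B * i symE by (auto simp: successively_append_iff)
      show "distinct (C1 @ B)" using dC dAB dis uA uC by auto
      show "distinct (A @ C2)" using dC dAB dis uA uC by auto
      show "set (C1 @ B) \<inter> set (A @ C2) \<subseteq> {u}" using dC dAB dis by auto
    qed (use * i lastB hdA hC in auto)
    then show False using none by blast
  qed
  have xX: "x \<notin> ?X" "x \<notin> ?Y" "y \<notin> ?X" "y \<notin> ?Y" using xy symE by auto
  \<comment> \<open>The centre \<open>u\<close> lies on all legs; it is counted with leg
    \<open>i\<close> alone.\<close>
  have split: "card (N \<inter> V) = card (N \<inter> set (P i)) + (\<Sum>j\<in>S-{i}. card (N \<inter> set (P j) - {u}))" for N
  proof -
    have "N \<inter> V = (N \<inter> set (P i)) \<union> (\<Union>j\<in>S-{i}. N \<inter> set (P j) - {u})"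
      using spanning_spider_cover[OF sp] i(1) D(6)[OF i(1)] by blast
    also have "card \<dots> = card (N \<inter> set (P i)) + card (\<Union>j\<in>S-{i}. N \<inter> set (P j) - {u})"
      using S spanning_spider_disjoint[OF sp i(1)] by (subst card_Un_disjoint) auto
    also have "card (\<Union>j\<in>S-{i}. N \<inter> set (P j) - {u}) = (\<Sum>j\<in>S-{i}. card (N \<inter> set (P j) - {u}))"
    proof (rule card_UN_disjoint)
      show "\<forall>a\<in>S - {i}. \<forall>b\<in>S - {i}. a \<noteq> b \<longrightarrow>
          (N \<inter> set (P a) - {u}) \<inter> (N \<inter> set (P b) - {u}) = {}"
        using spanning_spider_disjoint[OF sp] by blast
    qed (use S in auto)
    finally show ?thesis .
  qed
  have le_Diff: "card N \<le> card (N - {z}) + 1" if "finite N" for N :: "'a set" and z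
    using that card_Suc_Diff1[of N z] by (cases "z \<in> N") auto
  \<comment> \<open>If \<open>u\<close> is adjacent to \<open>y\<close>, the count on leg
    \<open>i\<close> loses 1, because \<open>u\<close> is excluded there as the head of
    \<open>A\<close>, but every other leg gains 1.\<close>
  define \<epsilon> :: nat where "\<epsilon> = (if u \<in> ?Y then 1 else 0)"
  have own: "card (?X \<inter> set (P i)) + card (?Y \<inter> set (P i)) + 1 \<le> card (set (P i)) + \<epsilon>"
  proof -
    have "card (N \<inter> set (P i)) = card (N \<inter> set A) + card (N \<inter> set B)" for N
      unfolding i(2) set_append Int_Un_distrib using dAB by (intro card_Un_disjoint) auto
    note this[of ?X] this[of ?Y] this[of UNIV]
    moreover have "?X \<inter> set A - {last A} = ?X \<inter> set A" "?Y \<inter> set B - {hd B} = ?Y \<inter> set B"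
      using xX i by auto
    moreover have "card (?Y \<inter> set A) \<le> card (?Y \<inter> set A - {hd A}) + \<epsilon>"
      using le_Diff[of "?Y \<inter> set A" u] uA hdA by (auto simp: \<epsilon>_def)
    moreover have "card (?X \<inter> set B) \<le> card (?X \<inter> set B - {last B}) + 1"
      by (rule le_Diff) simp
    ultimately show ?thesis using cA cB by simp
  qed
  have other: "card (?X \<inter> set (P j) - {u}) + card (?Y \<inter> set (P j) - {u}) + \<epsilon>
      \<le> card (set (P j) - {u}) + 1" if j: "j \<in> S - {i}" for j
  proof -
    have u: "u \<in> set (P j)" "hd (P j) = u" using D j by auto
    have "card (?Y \<inter> set (P j)) \<le> card (?Y \<inter> set (P j) - {last (P j)}) + 1"
      by (rule le_Diff) simp
    moreover have "card (?Y \<inter> set (P j)) = card (?Y \<inter> set (P j) - {u}) + \<epsilon>"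
      using u card_Suc_Diff1[of "?Y \<inter> set (P j)" u] by (auto simp: \<epsilon>_def)
    moreover have "card (set (P j)) = card (set (P j) - {u}) + 1"
      using u card_Suc_Diff1[of "set (P j)" u] by auto
    ultimately show ?thesis using cj[of j] j u(2) by simp
  qed
  \<comment> \<open>By \<open>card S \<ge> 2\<close> there is at least one other leg, so the gain
    \<open>q * \<epsilon>\<close> makes up for the \<epsilon> lost on leg \<open>i\<close>.\<close>
  obtain q where q: "card S = Suc q" "1 \<le> q" using S(2) by (cases "card S") auto
  then have cq: "card (S - {i}) = q" using i(1) S(1) by simp
  define \<sigma> where "\<sigma> N = (\<Sum>j\<in>S-{i}. card (N \<inter> set (P j) - {u}))" for N
  have "(\<Sum>j\<in>S-{i}. card (?X \<inter> set (P j) - {u}) + card (?Y \<inter> set (P j) - {u}) + \<epsilon>)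
      \<le> (\<Sum>j\<in>S-{i}. card (set (P j) - {u}) + 1)"
    using other by (rule sum_mono)
  then have sums: "\<sigma> ?X + \<sigma> ?Y + q * \<epsilon> \<le> \<sigma> UNIV + q"
    unfolding sum.distrib \<sigma>_def by (simp add: cq)
  have "\<epsilon> \<le> q * \<epsilon>" using q(2) by simp
  then have "\<sigma> ?X + \<sigma> ?Y + \<epsilon> \<le> \<sigma> UNIV + q" using sums by (meson add_left_mono le_trans)
  moreover have "?X \<inter> V = ?X" "?Y \<inter> V = ?Y" using E by auto
  then have "card ?X = card (?X \<inter> set (P i)) + \<sigma> ?X" "card ?Y = card (?Y \<inter> set (P i)) + \<sigma> ?Y"
    using split[of ?X] split[of ?Y] by (simp_all add: \<sigma>_def)
  moreover have "card V = card (set (P i)) + \<sigma> UNIV" using split[of UNIV] by (simp add: \<sigma>_def)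
  ultimately show ?thesis using own unfolding q(1) by linarith
qed

lemma successively_failure:
  assumes "successively R L" "\<not> successively R' L"
  shows "\<exists>A B. L = A @ B \<and> A \<noteq> [] \<and> B \<noteq> [] \<and> R (last A) (hd B) \<and> \<not> R' (last A) (hd B)"
  using assms
proof (induction L)
  case (Cons a L)
  then have L: "L \<noteq> []" "R a (hd L)" "successively R L" by (auto simp: successively_Cons)
  show ?case
  proof (cases "R' a (hd L)")
    case True
    then have "\<not> successively R' L" using Cons.prems L(1) by (simp add: successively_Cons)
    then obtain A B where "L = A @ B" "A \<noteq> []" "B \<noteq> []" "R (last A) (hd B)" "\<not> R' (last A) (hd B)"
      using Cons.IH L by blast
    then show ?thesis by (intro exI[of _ "a # A"] exI[of _ B]) auto
  next
    case False
    then show ?thesis using L by (intro exI[of _ "[a]"] exI[of _ L]) auto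
  qed
qed simp

text \<open>Since \<open>E\<close> itself has no spider, the given spider must use the new edge. It
  does so on one leg only, and cutting that leg there leaves two pieces that run inside
  \<open>E\<close>, as do all other legs; either orientation of the edge may occur.\<close>

lemma degree_sum_of_saturated_pair:
  assumes E: "sym E" "E \<subseteq> V \<times> V" "irrefl E" and fin: "finite V"
    and xy: "(x, y) \<notin> E" "x \<noteq> y"
    and S: "finite S" "card S \<ge> 2"
    and none: "\<And>P. \<not> spanning_spider V E u S P"
    and sp: "spanning_spider V (insert (x, y) (insert (y, x) E)) u S P"
  shows "card (E `` {x}) + card (E `` {y}) + 2 \<le> card V + card S"
proof -
  let ?E' = "insert (x, y) (insert (y, x) E)"
  note D = spanning_spiderD[OF sp]
  have irr: "(z, z) \<notin> E" for z using E(3) by (simp add: irrefl_def)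
  have yx: "(y, x) \<notin> E" using xy E(1) by (auto simp: sym_def)
  have restrict: "successively (\<lambda>a b. (a, b) \<in> E) L"
    if "successively (\<lambda>a b. (a, b) \<in> ?E') L" "\<not> (x \<in> set L \<and> y \<in> set L)" for L
    using that by (auto elim: successively_mono)
  obtain i where i: "i \<in> S" "\<not> successively (\<lambda>a b. (a, b) \<in> E) (P i)"
    using sp none[of P] unfolding spanning_spider_def by fast
  obtain A B where AB: "P i = A @ B" "A \<noteq> []" "B \<noteq> []"
    and e: "(last A, hd B) \<in> ?E'" "(last A, hd B) \<notin> E"
    using successively_failure[OF D(5)[OF i(1)] i(2)] by blast
  have last: "last A \<in> set A" "hd B \<in> set B" "set A \<inter> set B = {}" "hd A = u" "hd A \<in> set A"
    using D(4)[OF i(1)] D(2)[OF i(1)] AB by auto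
  have ends: "(last A = x \<and> hd B = y) \<or> (last A = y \<and> hd B = x)" using e by auto
  have "successively (\<lambda>a b. (a, b) \<in> ?E') A" "successively (\<lambda>a b. (a, b) \<in> ?E') B"
    using D(5)[OF i(1)] AB by (auto simp: successively_append_iff)
  then have sAB: "successively (\<lambda>a b. (a, b) \<in> E) A" "successively (\<lambda>a b. (a, b) \<in> E) B"
    using restrict last ends by blast+
  \<comment> \<open>The vertex \<open>hd B\<close> lies on leg \<open>i\<close> and differs from
    \<open>u\<close>, so no other leg contains it.\<close>
  have others: "successively (\<lambda>a b. (a, b) \<in> E) (P v)" if "v \<in> S" "v \<noteq> i" for v
  proof (rule restrict[OF D(5)[OF that(1)]])
    have "hd B \<in> set (P i)" using last(2) AB(1) by simp
    moreover have "hd B \<noteq> u" using last(2-5) by (metis disjoint_iff)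
    ultimately have "hd B \<notin> set (P v)" using spanning_spider_disjoint[OF sp i(1) that(1)] that by auto
    then show "\<not> (x \<in> set (P v) \<and> y \<in> set (P v))" using ends by auto
  qed
  show ?thesis
    using ends
  proof
    assume "last A = x \<and> hd B = y"
    then show ?thesis
      using degree_sum_of_broken_spider[OF E(1,2) fin xy(1) irr irr S none sp i(1) AB _ _ sAB others]
      by blast
  next
    assume "last A = y \<and> hd B = x"
    then show ?thesis
      using degree_sum_of_broken_spider[OF E(1,2) fin yx irr irr S none sp i(1) AB _ _ sAB others]
      by (simp add: add.commute)
  qed
qed

text \<open>All vertices other than \<open>u\<close> and the feet are put on one leg, the remaining
  legs being single edges. Hence a relation without a spider leaves some pair nonadjacent.\<close>

lemma spanning_spider_complete:
  assumes V: "finite V" and u: "u \<in> V" and S: "S \<subseteq> V - {u}" "S \<noteq> {}"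
  shows "\<exists>P. spanning_spider V (V \<times> V - Id) u S P"
proof -
  obtain s where s: "s \<in> S" using S by blast
  obtain M where M: "distinct M" "set M = V - {u} - S"
    using finite_distinct_list[of "V - {u} - S"] V by auto
  define P where "P = (\<lambda>v. [u, v])(s := u # M @ [s])"
  have succ: "successively (\<lambda>a b. (a, b) \<in> V \<times> V - Id) L" if "set L \<subseteq> V" "distinct L" for L
    using that by (induction L) (auto simp: successively_Cons)
  have "spanning_spider V (V \<times> V - Id) u S P"
    unfolding spanning_spider_def
  proof (intro conjI ballI impI)
    fix v assume v: "v \<in> S"
    show "P v \<noteq> []" "hd (P v) = u" "last (P v) = v" "distinct (P v)"
      using v s S(1) M by (auto simp: P_def)
    then show "successively (\<lambda>a b. (a, b) \<in> V \<times> V - Id) (P v)"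
      using v s S(1) M u by (intro succ) (auto simp: P_def)
  next
    fix v v' assume "v \<in> S" "v' \<in> S" "v \<noteq> v'"
    then show "set (P v) \<inter> set (P v') \<subseteq> {u}" using M by (auto simp: P_def)
  next
    have "(\<Union>v\<in>S. set (P v)) = set (P s) \<union> (\<Union>v\<in>S-{s}. {u, v})"
      using s by (auto simp: P_def split: if_splits)
    then show "(\<Union>v\<in>S. set (P v)) = V" using s S(1) M u by (auto simp: P_def)
  qed
  then show ?thesis by blast
qed

section \<open>The edge bound\<close>

text \<open>Convexity: if the value at \<open>k\<close> exceeded both end values, the chord slopes
  \<open>3 * (k + a) - c\<close> and \<open>3 * (k + b) - c\<close> would change from positive to
  negative, although \<open>a \<le> b\<close>.\<close>

lemma quadratic_le_max_ends:
  fixes a b :: int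
  assumes "a \<le> k" "k \<le> b"
  shows "3 * k\<^sup>2 - c * k \<le> max (3 * a\<^sup>2 - c * a) (3 * b\<^sup>2 - c * b)"
proof (rule ccontr)
  assume "\<not> ?thesis"
  then have *: "(k - a) * (3 * (k + a) - c) > 0" "(b - k) * (3 * (k + b) - c) < 0"
    by (auto simp: algebra_simps power2_eq_square)
  then have "3 * (k + a) - c > 0" "3 * (k + b) - c < 0"
    using assms by (auto simp: zero_less_mult_iff mult_less_0_iff)
  then have "3 * a > 3 * b" by (simp add: algebra_simps)
  then show False using assms by linarith
qed

lemma double_choose_two: "2 * int (m choose 2) = int m * (int m - 1)"
proof -
  have "even (m * (m - 1))" by auto
  then have "2 * (m choose 2) = m * (m - 1)" unfolding choose_two by (rule dvd_mult_div_cancel)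
  then have "int (2 * (m choose 2)) = int (m * (m - 1))" by (rule arg_cong)
  then show ?thesis by (cases m) (auto simp: algebra_simps)
qed

text \<open>Over the integers the left side is a quadratic in \<open>k\<close> with leading
  coefficient 3, the other coefficients depending only on \<open>n\<close>, \<open>t\<close> and
  \<delta>. Its values at \<delta> and at \<open>h\<close> are twice the two edge bounds; the
  doubling clears the binomial coefficients.\<close>

lemma edge_count_le_edge_bounds:
  fixes n t \<delta> k :: nat
  assumes "2 \<le> t" "t + 1 \<le> \<delta>" "\<delta> \<le> k" "2 * k + 2 \<le> n + t"
  shows "(n + t - k - 1) * (n + t - k - 2) + 2 * ((k - t) * k + \<delta>)
    \<le> 2 * max (edge_bound_f n t \<delta>) (edge_bound_g n t \<delta>)"
proof -
  define h where "h = (n + t - 2) div 2"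
  have h: "k \<le> h" "2 * h + 2 \<le> n + t" using assms unfolding h_def by auto
  let ?N = "int n + int t"
  let ?q = "\<lambda>j. 3 * j\<^sup>2 - (2 * ?N - 3 + 2 * int t) * j"
  let ?d = "(?N - 1) * (?N - 2) + 2 * int \<delta>"
  have f: "2 * int (edge_bound_f n t \<delta>) = ?q (int \<delta>) + ?d"
    unfolding edge_bound_f_def of_nat_add of_nat_mult distrib_left double_choose_two
    using assms h by (simp add: of_nat_diff algebra_simps power2_eq_square)
  have g: "2 * int (edge_bound_g n t \<delta>) = ?q (int h) + ?d"
    unfolding edge_bound_g_def Let_def h_def[symmetric] of_nat_add of_nat_mult distrib_left double_choose_two
    using assms h by (simp add: of_nat_diff algebra_simps power2_eq_square)
  have l: "int ((n + t - k - 1) * (n + t - k - 2) + 2 * ((k - t) * k + \<delta>)) = ?q (int k) + ?d"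
    unfolding of_nat_add of_nat_mult
    using assms h by (simp add: of_nat_diff algebra_simps power2_eq_square)
  have "?q (int k) \<le> max (?q (int \<delta>)) (?q (int h))"
    using assms h by (intro quadratic_le_max_ends) auto
  then have "?q (int k) + ?d \<le> 2 * max (int (edge_bound_f n t \<delta>)) (int (edge_bound_g n t \<delta>))"
    using f g by linarith
  then have "int ((n + t - k - 1) * (n + t - k - 2) + 2 * ((k - t) * k + \<delta>))
      \<le> int (2 * max (edge_bound_f n t \<delta>) (edge_bound_g n t \<delta>))"
    unfolding l by (simp only: of_nat_mult of_nat_max of_nat_numeral)
  then show ?thesis by (simp only: of_nat_le_iff)
qed

text \<open>An arc leaves \<open>Y\<close>, enters \<open>Y\<close>, or joins two distinct vertices
  outside \<open>Y\<close>. By symmetry as many arcs enter \<open>Y\<close> as leave it.\<close>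

lemma card_edges_le_of_low_degrees:
  assumes E: "sym E" "irrefl E" "E \<subseteq> V \<times> V" and V: "finite V" and Y: "Y \<subseteq> V"
  shows "card E \<le> 2 * (\<Sum>v\<in>Y. card (E `` {v})) + (card V - card Y) * (card V - card Y - 1)"
proof -
  let ?F = "SIGMA v:Y. E `` {v}" and ?W = "V - Y"
  have fin: "finite Y" "finite (E `` {v})" for v
    using finite_subset[OF Y V] finite_subset[of "E `` {v}" V] E V by auto
  have "E \<subseteq> (?F \<union> ?F\<inverse>) \<union> (SIGMA v:?W. ?W - {v})"
    using E by (auto simp: sym_def irrefl_def)
  then have "card E \<le> card ((?F \<union> ?F\<inverse>) \<union> (SIGMA v:?W. ?W - {v}))"
    by (rule card_mono[rotated]) (use fin V in \<open>auto intro!: finite_SigmaI\<close>)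
  also have "\<dots> \<le> card ?F + card (?F\<inverse>) + card (SIGMA v:?W. ?W - {v})"
    by (meson card_Un_le add_le_mono1 le_trans)
  also have "card (?F\<inverse>) = card ?F" by (rule card_inverse)
  also have "card ?F = (\<Sum>v\<in>Y. card (E `` {v}))" using fin by simp
  also have "card (SIGMA v:?W. ?W - {v}) = card ?W * (card ?W - 1)" using V by simp
  also have "card ?W = card V - card Y" using Y V fin by (simp add: card_Diff_subset)
  finally show ?thesis by simp
qed

text \<open>Saturation produces the vertices of low degree, but edges are counted in
  \<open>E\<close>, where \<open>z\<close> has degree exactly \<delta>; degree bounds in the
  saturated relation pass down to \<open>E\<close>. The factor 2 is due to \<open>E\<close>
  containing both directions of each edge.\<close>

lemma spider_free_edge_bound:
  assumes E: "sym E" "irrefl E" "E \<subseteq> V \<times> V" and V: "finite V" "card V = n"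
    and \<delta>: "\<And>v. v \<in> V \<Longrightarrow> \<delta> \<le> card (E `` {v})" and z: "z \<in> V" "card (E `` {z}) = \<delta>"
    and t: "2 \<le> t" "t + 1 \<le> \<delta>"
    and S: "u \<in> V" "S \<subseteq> V - {u}" "card S = t"
    and none: "\<And>P. \<not> spanning_spider V E u S P"
  shows "card E \<le> 2 * max (edge_bound_f n t \<delta>) (edge_bound_g n t \<delta>)"
proof -
  have finS: "finite S" "S \<noteq> {}" using S t V finite_subset[of S V] by auto
  \<comment> \<open>These are the spider-free relations between \<open>E\<close> and the complete
    one; a maximal member is the saturated graph.\<close>
  define \<E> where "\<E> = {F. E \<subseteq> F \<and> F \<subseteq> V \<times> V - Id \<and> sym F \<and> (\<forall>P. \<not> spanning_spider V F u S P)}"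
  have "finite \<E>" by (rule finite_subset[of _ "Pow (V \<times> V)"]) (use V in \<open>auto simp: \<E>_def\<close>)
  moreover have "E \<in> \<E>" using E none by (auto simp: \<E>_def irrefl_def)
  ultimately obtain F where F: "F \<in> \<E>" and max: "\<And>F'. F' \<in> \<E> \<Longrightarrow> F \<subseteq> F' \<Longrightarrow> F' = F"
    using finite_has_maximal[of \<E>] by (metis empty_iff)
  have F': "sym F" "irrefl F" "F \<subseteq> V \<times> V" "E \<subseteq> F" "\<And>P. \<not> spanning_spider V F u S P"
    using F by (auto simp: \<E>_def irrefl_def)
  let ?d = "\<lambda>v. card (F `` {v})"
  have finF: "finite (F `` {v})" "F `` {v} \<subseteq> V" for v
    using finite_subset[of "F `` {v}" V] F' V by auto
  have dF: "card (E `` {v}) \<le> ?d v" for v using finF F'(4) by (intro card_mono) auto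
  define Q where "Q = {p \<in> V \<times> V - Id. p \<notin> F}"
  have ore: "?d x + ?d y + 2 \<le> n + t" if "(x, y) \<in> Q" for x y
  proof -
    let ?F' = "insert (x, y) (insert (y, x) F)"
    have xy: "x \<in> V" "y \<in> V" "x \<noteq> y" "(x, y) \<notin> F" using that by (auto simp: Q_def)
    have "?F' \<notin> \<E>" using max[of ?F'] xy by auto
    moreover have "sym ?F'" using F'(1) by (auto simp: sym_def)
    ultimately obtain P where "spanning_spider V ?F' u S P" using F xy by (auto simp: \<E>_def)
    then show ?thesis
      using degree_sum_of_saturated_pair[OF F'(1,3,2) V(1) xy(4,3) finS(1) _ F'(5)] t S V by auto
  qed
  have "F \<noteq> V \<times> V - Id" using spanning_spider_complete[OF V(1) S(1,2) finS(2)] F'(5) by auto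
  then have "Q \<noteq> {}" using F by (auto simp: Q_def \<E>_def)
  moreover have "finite Q" using V by (auto simp: Q_def)
  ultimately obtain p where p: "p \<in> Q" "\<And>q. q \<in> Q \<Longrightarrow> ?d (fst q) + ?d (snd q) \<le> ?d (fst p) + ?d (snd p)"
    using finite_has_maximal[of "(\<lambda>q. ?d (fst q) + ?d (snd q)) ` Q"]
    by (smt (verit) finite_imageI image_iff image_is_empty linorder_le_cases)
  have swap: "(b, a) \<in> Q" if "(a, b) \<in> Q" for a b using that F'(1) by (auto simp: Q_def sym_def)
  obtain x y where xy: "(x, y) \<in> Q" "?d x \<le> ?d y"
    and mx: "\<And>a b. (a, b) \<in> Q \<Longrightarrow> ?d a + ?d b \<le> ?d x + ?d y"
  proof (cases "?d (fst p) \<le> ?d (snd p)")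
    case True then show ?thesis using that[of "fst p" "snd p"] p by fastforce
  next
    case False then show ?thesis
      using that[of "snd p" "fst p"] p swap[of "fst p" "snd p"] by (fastforce simp: add.commute)
  qed
  have xyV: "x \<in> V" "y \<in> V" using xy by (auto simp: Q_def)
  define k where "k = ?d x"
  have k: "2 * k + 2 \<le> n + t" "\<delta> \<le> k"
    using ore[OF xy(1)] xy(2) \<delta>[OF xyV(1)] dF[of x] by (auto simp: k_def)
  \<comment> \<open>These are the nonneighbours of \<open>y\<close>. Putting one of them in place of
    \<open>x\<close> cannot raise the maximal degree sum, so their degrees are at most
    \<open>k\<close>.\<close>
  define X where "X = V - {y} - F `` {y}"
  have Xk: "card (E `` {v}) \<le> k" if "v \<in> X" for v
  proof -
    have "(v, y) \<in> Q" using that xyV F'(1) by (auto simp: X_def Q_def sym_def)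
    from mx[OF this] show ?thesis using dF[of v] by (simp add: k_def)
  qed
  have "F `` {y} \<subseteq> V - {y}" using F'(2) finF by (auto simp: irrefl_def)
  then have "card X = n - 1 - ?d y"
    unfolding X_def using finF V xyV by (simp add: card_Diff_subset)
  \<comment> \<open>From \<open>k + ?d y + 2 \<le> n + t\<close> it follows that \<open>X\<close>
    has at least \<open>k - t + 1\<close> elements. The vertex \<open>z\<close> is set aside and
    added again afterwards with its exact degree, which gives the summand \<delta> of the
    bound.\<close>
  then have "k - t \<le> card (X - {z})"
    using ore[OF xy(1)] V(1) t by (auto simp: k_def card_Diff_singleton_if X_def)
  then obtain W where W: "W \<subseteq> X - {z}" "card W = k - t" "finite W"
    using obtain_subset_with_card_n by metis
  have W': "z \<notin> W" "insert z W \<subseteq> V" using W z by (auto simp: X_def)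
  have cY: "card (insert z W) = k - t + 1" using W W' by simp
  have "(\<Sum>v\<in>insert z W. card (E `` {v})) = \<delta> + (\<Sum>v\<in>W. card (E `` {v}))"
    using W W' z by simp
  also have "\<dots> \<le> \<delta> + (k - t) * k"
    using sum_bounded_above[of W "\<lambda>v. card (E `` {v})" k] W Xk by auto
  finally have low: "(\<Sum>v\<in>insert z W. card (E `` {v})) \<le> \<delta> + (k - t) * k" .
  have "card E \<le> 2 * (\<Sum>v\<in>insert z W. card (E `` {v})) + (n - (k - t + 1)) * (n - (k - t + 1) - 1)"
    using card_edges_le_of_low_degrees[OF E V(1) W'(2)] unfolding cY V(2) .
  also have "\<dots> \<le> 2 * (\<delta> + (k - t) * k) + (n - (k - t + 1)) * (n - (k - t + 1) - 1)"
    using low by (intro add_mono mult_left_mono) auto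
  also have "n - (k - t + 1) = n + t - k - 1" using k t by auto
  also have "2 * (\<delta> + (k - t) * k) + (n + t - k - 1) * (n + t - k - 1 - 1) =
      (n + t - k - 1) * (n + t - k - 2) + 2 * ((k - t) * k + \<delta>)"
    by (simp add: algebra_simps)
  also have "\<dots> \<le> 2 * max (edge_bound_f n t \<delta>) (edge_bound_g n t \<delta>)"
    by (rule edge_count_le_edge_bounds[OF t k(2,1)])
  finally show ?thesis .
qed

section \<open>Eigenvalues\<close>

lemma eigenvector_sum:
  assumes A: "A \<in> carrier_mat n n" and v: "eigenvector A v \<mu>" and i: "i < n"
  shows "(\<Sum>j<n. A $$ (i, j) * v $ j) = \<mu> * v $ i"
proof -
  have dv: "dim_vec v = n" and e: "A *\<^sub>v v = \<mu> \<cdot>\<^sub>v v" using v A by (auto simp: eigenvector_def)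
  have "(A *\<^sub>v v) $ i = (\<Sum>j<n. A $$ (i, j) * v $ j)"
    using A i dv by (simp add: scalar_prod_def lessThan_atLeast0)
  then show ?thesis using e dv i by simp
qed

lemma eigenvector_nonzero_entry:
  assumes "A \<in> carrier_mat n n" "eigenvector A v \<mu>"
  obtains i where "i < n" "v $ i \<noteq> 0"
proof -
  have "v \<in> carrier_vec n" "v \<noteq> 0\<^sub>v n" using assms by (auto simp: eigenvector_def)
  then show ?thesis using that by (metis carrier_vecD eq_vecI index_zero_vec)
qed

lemma eigenvalueI_sum:
  assumes A: "A \<in> carrier_mat n n" and e: "\<And>i. i < n \<Longrightarrow> (\<Sum>j<n. A $$ (i, j) * f j) = \<mu> * f i"
    and nz: "k < n" "f k \<noteq> 0"
  shows "eigenvalue A \<mu>"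
proof -
  have "A *\<^sub>v vec n f = \<mu> \<cdot>\<^sub>v vec n f"
    using A e by (intro eq_vecI) (auto simp: scalar_prod_def lessThan_atLeast0)
  moreover have "vec n f \<noteq> 0\<^sub>v n" using nz by (metis index_vec index_zero_vec(1))
  ultimately show ?thesis using A unfolding eigenvalue_def eigenvector_def by (intro exI[of _ "vec n f"]) auto
qed

text \<open>A complex eigenvalue exists and is real by symmetry. This makes the maximum in the
  definition of the spectral radius an actual eigenvalue.\<close>

lemma spectrum_real_symmetric_nonempty:
  fixes A :: "real mat"
  assumes A: "A \<in> carrier_mat n n" and n: "n > 0"
    and symm: "\<And>i j. i < n \<Longrightarrow> j < n \<Longrightarrow> A $$ (i, j) = A $$ (j, i)"
  shows "spectrum A \<noteq> {}"
proof -
  let ?C = "map_mat complex_of_real A"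
  have C: "?C \<in> carrier_mat n n" using A by auto
  obtain l v where v: "eigenvector ?C v l"
    using spectrum_non_empty[OF C n] by (auto simp: spectrum_def eigenvalue_def)
  have e: "(\<Sum>j<n. complex_of_real (A $$ (i, j)) * v $ j) = l * v $ i" if "i < n" for i
    using eigenvector_sum[OF C v that] A that by simp
  obtain k where k: "k < n" "v $ k \<noteq> 0" by (rule eigenvector_nonzero_entry[OF C v])
  define N where "N = (\<Sum>i<n. (cmod (v $ i))\<^sup>2)"
  have "N > 0" unfolding N_def using k by (intro sum_pos2[of _ k]) auto
  \<comment> \<open>The Hermitian form at \<open>v\<close>: it equals \<open>l * N\<close> by the
    eigenvector equation and is its own conjugate by symmetry.\<close>
  define H where "H = (\<Sum>i<n. cnj (v $ i) * (\<Sum>j<n. complex_of_real (A $$ (i, j)) * v $ j))"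
  have "H = (\<Sum>i<n. l * of_real ((cmod (v $ i))\<^sup>2))"
    unfolding H_def complex_norm_square
  proof (intro sum.cong refl)
    fix i assume "i \<in> {..<n}"
    then show "cnj (v $ i) * (\<Sum>j<n. complex_of_real (A $$ (i, j)) * v $ j) = l * (v $ i * cnj (v $ i))"
      by (subst e) (simp_all add: mult_ac)
  qed
  then have H: "H = l * of_real N" unfolding N_def of_real_sum sum_distrib_left .
  have "cnj H = (\<Sum>i<n. \<Sum>j<n. v $ i * (complex_of_real (A $$ (i, j)) * cnj (v $ j)))"
    by (simp add: H_def sum_distrib_left)
  also have "\<dots> = (\<Sum>j<n. \<Sum>i<n. v $ i * (complex_of_real (A $$ (i, j)) * cnj (v $ j)))"
    by (rule sum.swap)
  also have "\<dots> = H"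
    unfolding H_def sum_distrib_left using symm by (intro sum.cong) (auto simp: mult_ac)
  finally have "cnj l = l" using H \<open>N > 0\<close> by simp
  then obtain r where r: "l = complex_of_real r" by (metis Reals_cases Reals_cnj_iff)
  \<comment> \<open>As \<open>A\<close> and \<open>r\<close> are real, the real and imaginary parts
    of \<open>v\<close> satisfy the equation separately, and one of them is nonzero at
    \<open>k\<close>.\<close>
  have "(\<Sum>j<n. A $$ (i, j) * Re (v $ j)) = r * Re (v $ i)" 
       "(\<Sum>j<n. A $$ (i, j) * Im (v $ j)) = r * Im (v $ i)" if "i < n" for i
    using arg_cong[OF e[OF that], of Re] arg_cong[OF e[OF that], of Im] by (simp_all add: r)
  moreover have "Re (v $ k) \<noteq> 0 \<or> Im (v $ k) \<noteq> 0" using k by (auto simp: complex_eq_iff)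
  ultimately have "eigenvalue A r"
    using eigenvalueI_sum[OF A, of "\<lambda>j. Re (v $ j)"] eigenvalueI_sum[OF A, of "\<lambda>j. Im (v $ j)"] k(1)
    by blast
  then show ?thesis by (auto simp: spectrum_def)
qed

text \<open>Replacing an eigenvector by its entrywise absolute value \<open>y\<close> gives \<open>A y \<ge> \<mu> y\<close>; this
  inequality takes the place of a Perron vector.\<close>

lemma eigenvalue_le_of_column_sums:
  fixes A :: "real mat"
  assumes A: "A \<in> carrier_mat n n" and nonneg: "\<And>i j. i < n \<Longrightarrow> j < n \<Longrightarrow> 0 \<le> A $$ (i, j)"
    and r: "\<And>j. j < n \<Longrightarrow> (\<Sum>i<n. A $$ (i, j)) = r j"
    and r2: "\<And>j. j < n \<Longrightarrow> (\<Sum>i<n. r i * A $$ (i, j)) \<le> c * r j + R"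
    and \<mu>: "eigenvalue A \<mu>" "c \<le> \<mu>" "0 \<le> \<mu>"
  shows "\<mu>\<^sup>2 \<le> c * \<mu> + R"
proof -
  obtain v where v: "eigenvector A v \<mu>" using \<mu> by (auto simp: eigenvalue_def)
  define y where "y = (\<lambda>i. \<bar>v $ i\<bar>)"
  have y0: "0 \<le> y i" for i by (simp add: y_def)
  obtain k where k: "k < n" "v $ k \<noteq> 0" by (rule eigenvector_nonzero_entry[OF A v])
  define s where "s = (\<Sum>i<n. y i)"
  have s: "s > 0" unfolding s_def using k by (intro sum_pos2[of _ k]) (auto simp: y_def)
  have sub: "\<mu> * y i \<le> (\<Sum>j<n. A $$ (i, j) * y j)" if i: "i < n" for i
  proof -
    have "\<mu> * y i = \<bar>\<Sum>j<n. A $$ (i, j) * v $ j\<bar>"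
      using eigenvector_sum[OF A v i] \<mu>(3) by (simp add: y_def abs_mult)
    also have "\<dots> \<le> (\<Sum>j<n. \<bar>A $$ (i, j) * v $ j\<bar>)" by (rule sum_abs)
    also have "\<dots> = (\<Sum>j<n. A $$ (i, j) * y j)"
      using nonneg i by (intro sum.cong) (auto simp: abs_mult y_def)
    finally show ?thesis .
  qed
  have r0: "0 \<le> r j" if "j < n" for j using r[OF that] nonneg that by (metis lessThan_iff sum_nonneg)
  \<comment> \<open>\<open>T\<close> is the entry sum of \<open>A y\<close>, so summing
    \<open>A y \<ge> \<mu> y\<close> gives \<open>\<mu> * s \<le> T\<close>.\<close>
  define T where "T = (\<Sum>j<n. r j * y j)"
  have "\<mu> * s \<le> (\<Sum>i<n. \<Sum>j<n. A $$ (i, j) * y j)"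
    unfolding s_def sum_distrib_left by (intro sum_mono) (auto intro: sub)
  also have "\<dots> = (\<Sum>j<n. \<Sum>i<n. A $$ (i, j) * y j)" by (rule sum.swap)
  also have "\<dots> = T" unfolding T_def by (intro sum.cong) (auto simp: sum_distrib_right simp flip: r)
  finally have T: "\<mu> * s \<le> T" .
  \<comment> \<open>Weighting the same inequality by the column sums \<open>r\<close> amounts to a
    second application of \<open>A\<close>, which \<open>r2\<close> controls.\<close>
  have "\<mu> * T = (\<Sum>i<n. r i * (\<mu> * y i))" by (simp add: T_def sum_distrib_left mult_ac)
  also have "\<dots> \<le> (\<Sum>i<n. r i * (\<Sum>j<n. A $$ (i, j) * y j))"
    by (intro sum_mono mult_left_mono) (auto intro: sub r0)
  also have "\<dots> = (\<Sum>i<n. \<Sum>j<n. r i * A $$ (i, j) * y j)"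
    by (simp add: sum_distrib_left mult_ac)
  also have "\<dots> = (\<Sum>j<n. \<Sum>i<n. r i * A $$ (i, j) * y j)" by (rule sum.swap)
  also have "\<dots> \<le> (\<Sum>j<n. (c * r j + R) * y j)"
    unfolding sum_distrib_right[symmetric] by (intro sum_mono mult_right_mono) (auto intro: r2 y0)
  also have "\<dots> = c * T + R * s"
    by (simp add: T_def s_def sum_distrib_left algebra_simps sum.distrib)
  finally have "(\<mu> - c) * T \<le> R * s" by (simp add: algebra_simps)
  \<comment> \<open>Here \<open>c \<le> \<mu>\<close> keeps the direction of the inequality;
    afterwards the positive factor \<open>s\<close> is cancelled.\<close>
  moreover have "(\<mu> - c) * (\<mu> * s) \<le> (\<mu> - c) * T" using T \<mu>(2) by (intro mult_left_mono) auto
  ultimately have "((\<mu> - c) * \<mu>) * s \<le> R * s" by simp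
  then have "(\<mu> - c) * \<mu> \<le> R" using s by simp
  then show ?thesis by (simp add: algebra_simps power2_eq_square)
qed

section \<open>Degrees, the matrix \<open>A_alpha\<close> and the bound on its largest
  eigenvalue\<close>

context pair_graph
begin

lemma parcs_symD: "(p, q) \<in> parcs G \<Longrightarrow> (q, p) \<in> parcs G"
  using pair_sym_arcs by (auto simp: symmetric_def sym_def)

lemma out_degree_eq_card_Image: "out_degree (with_proj G) v = card (parcs G `` {v})"
proof -
  have "out_arcs (with_proj G) v = Pair v ` (parcs G `` {v})" by (auto simp: out_arcs_def)
  then show ?thesis by (simp add: out_degree_def card_image inj_on_def)
qed

lemma sum_out_degree: "(\<Sum>v\<in>pverts G. out_degree (with_proj G) v) = card (parcs G)"
proof -
  have "parcs G = (SIGMA v:pverts G. parcs G `` {v})" using in_arcsD1 by auto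
  moreover have "finite (parcs G `` {v})" for v using pair_finite_arcs by (rule finite_Image)
  ultimately show ?thesis
    unfolding out_degree_eq_card_Image using pair_finite_verts by (metis (no_types, lifting) card_SigmaI sum.cong)
qed

lemma min_degree_le: "v \<in> pverts G \<Longrightarrow> min_degree G \<le> out_degree (with_proj G) v"
  unfolding min_degree_def using pair_finite_verts by (intro Min_le) auto

lemma min_degree_attained:
  assumes "pverts G \<noteq> {}"
  obtains z where "z \<in> pverts G" "out_degree (with_proj G) z = min_degree G"
proof -
  have "min_degree G \<in> out_degree (with_proj G) ` pverts G"
    unfolding min_degree_def using assms pair_finite_verts by (intro Min_in) auto
  then show ?thesis using that by auto
qed

lemma Image_parcs:
  "finite (parcs G `` {q})" "parcs G `` {q} \<subseteq> pverts G" "q \<notin> parcs G `` {q}"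
  using pair_finite_arcs in_arcsD2 pair_no_loops[of "(q, q)"] by (auto intro: finite_Image)

lemma out_degree_less: "q \<in> pverts G \<Longrightarrow> out_degree (with_proj G) q < card (pverts G)"
  unfolding out_degree_eq_card_Image
  using Image_parcs[of q] pair_finite_verts by (intro psubset_card_mono) auto

text \<open>All degrees add up to the number of arcs. Besides the neighbours of \<open>q\<close>,
  this sum contains \<open>q\<close> itself and its nonneighbours, each of at least the minimum
  degree.\<close>

lemma sum_neighbour_degrees_le:
  assumes q: "q \<in> pverts G"
  shows "(\<Sum>p\<in>parcs G `` {q}. real (out_degree (with_proj G) p)) \<le> real (card (parcs G))
    - real (out_degree (with_proj G) q)
    - (real (card (pverts G)) - 1 - real (out_degree (with_proj G) q)) * real (min_degree G)"
proof -
  let ?d = "\<lambda>p. real (out_degree (with_proj G) p)" and ?N = "parcs G `` {q}"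
  let ?M = "pverts G - insert q ?N"
  have V: "pverts G = ?N \<union> insert q ?M" using Image_parcs[of q] q by auto
  have "real (card (parcs G)) = sum ?d (pverts G)" using sum_out_degree by (metis of_nat_sum)
  also have "\<dots> = sum ?d ?N + sum ?d (insert q ?M)"
    using Image_parcs[of q] pair_finite_verts by (subst V, subst sum.union_disjoint) auto
  also have "sum ?d (insert q ?M) = ?d q + sum ?d ?M"
    using pair_finite_verts by simp
  finally have *: "real (card (parcs G)) = sum ?d ?N + (?d q + sum ?d ?M)" .
  have "card ?M = card (pverts G) - card (insert q ?N)"
    using Image_parcs[of q] q by (intro card_Diff_subset) auto
  moreover have "card (insert q ?N) = Suc (out_degree (with_proj G) q)"
    using Image_parcs[of q] by (simp add: out_degree_eq_card_Image)
  ultimately have "real (card ?M) = real (card (pverts G)) - 1 - ?d q"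
    using out_degree_less[OF q] by (simp add: of_nat_diff)
  moreover have "of_nat (card ?M) * real (min_degree G) \<le> sum ?d ?M"
    by (rule sum_bounded_below) (auto intro: min_degree_le)
  ultimately show ?thesis using * by simp
qed

lemma min_degree_mult_le_card_parcs: "card (pverts G) * min_degree G \<le> card (parcs G)"
  using sum_bounded_below[of "pverts G" "min_degree G" "out_degree (with_proj G)"] min_degree_le
  by (simp add: sum_out_degree)

text \<open>The diagonal is described by equal vertices instead of equal positions, so that sums
  over positions turn into sums over vertices.\<close>

lemma A_alpha_entry:
  assumes "distinct vs" "i < length vs" "j < length vs"
  shows "A_alpha \<alpha> G vs $$ (i, j) =
    (if vs ! i = vs ! j then \<alpha> * real (out_degree (with_proj G) (vs ! j)) else 0)
    + (1 - \<alpha>) * (if (vs ! i, vs ! j) \<in> parcs G then 1 else 0)"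
  using assms by (auto simp: A_alpha_def degree_matrix_def adjacency_matrix_def mat_diag_def nth_eq_iff_index_eq)

lemma A_alpha_carrier: "A_alpha \<alpha> G vs \<in> carrier_mat (length vs) (length vs)"
  by (simp add: A_alpha_def degree_matrix_def adjacency_matrix_def mat_diag_def)

lemma sum_nth_vertices:
  assumes "distinct vs" "set vs = pverts G"
  shows "(\<Sum>i<length vs. f (vs ! i)) = (\<Sum>v\<in>pverts G. f v)"
  using sum.reindex_bij_betw[OF bij_betw_nth[OF assms(1) refl assms(2)[symmetric]]] .

text \<open>For constant \<open>f = 1\<close> this gives the column sums, which are the degrees; for
  \<open>f\<close> the degree it gives the column sums of the squared matrix.\<close>

lemma sum_weighted_A_alpha_column:
  assumes vs: "distinct vs" "set vs = pverts G" and j: "j < length vs"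
  shows "(\<Sum>i<length vs. f (vs ! i) * A_alpha \<alpha> G vs $$ (i, j)) =
    \<alpha> * real (out_degree (with_proj G) (vs ! j)) * f (vs ! j)
    + (1 - \<alpha>) * (\<Sum>p\<in>parcs G `` {vs ! j}. f p)"
proof -
  let ?q = "vs ! j"
  have q: "?q \<in> pverts G" using nth_mem[OF j] vs(2) by simp
  have "(\<Sum>i<length vs. f (vs ! i) * A_alpha \<alpha> G vs $$ (i, j)) = (\<Sum>i<length vs.
      (\<lambda>p. (if p = ?q then f p * (\<alpha> * real (out_degree (with_proj G) ?q)) else 0)
      + (1 - \<alpha>) * (if p \<in> parcs G `` {?q} then f p else 0)) (vs ! i))"
  proof (intro sum.cong refl)
    fix i assume "i \<in> {..<length vs}"
    then have i: "i < length vs" by simp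
    have "(vs ! i, ?q) \<in> parcs G \<longleftrightarrow> vs ! i \<in> parcs G `` {?q}" using parcs_symD by blast
    then show "f (vs ! i) * A_alpha \<alpha> G vs $$ (i, j) =
      (\<lambda>p. (if p = ?q then f p * (\<alpha> * real (out_degree (with_proj G) ?q)) else 0)
      + (1 - \<alpha>) * (if p \<in> parcs G `` {?q} then f p else 0)) (vs ! i)"
      unfolding A_alpha_entry[OF vs(1) i j] by (simp add: algebra_simps)
  qed
  also have "\<dots> = (\<Sum>p\<in>pverts G. (if p = ?q then f p * (\<alpha> * real (out_degree (with_proj G) ?q)) else 0)
      + (1 - \<alpha>) * (if p \<in> parcs G `` {?q} then f p else 0))"
    by (rule sum_nth_vertices[OF vs])
  also have "\<dots> = (\<Sum>p\<in>pverts G. if p = ?q then f p * (\<alpha> * real (out_degree (with_proj G) ?q)) else 0)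
      + (1 - \<alpha>) * (\<Sum>p\<in>pverts G. if p \<in> parcs G `` {?q} then f p else 0)"
    by (simp only: sum.distrib sum_distrib_left)
  also have "(\<Sum>p\<in>pverts G. if p = ?q then f p * (\<alpha> * real (out_degree (with_proj G) ?q)) else 0)
      = \<alpha> * real (out_degree (with_proj G) ?q) * f ?q"
    using q pair_finite_verts by simp
  also have "(\<Sum>p\<in>pverts G. if p \<in> parcs G `` {?q} then f p else 0) = (\<Sum>p\<in>parcs G `` {?q}. f p)"
    using Image_parcs(2)[of ?q] pair_finite_verts
    by (subst sum.inter_restrict[symmetric]) (auto simp: Int_absorb1)
  finally show ?thesis .
qed

text \<open>The right side is the larger root of \<open>x^2 = c * x + R\<close> with
  \<open>R = (1 - \<alpha>) * (m - n * d + d)\<close>. Here \<open>m\<close> bounds the number of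
  arcs, that is, twice the number of edges.\<close>

lemma alpha_spectral_radius_le:
  assumes \<alpha>: "0 \<le> \<alpha>" "\<alpha> \<le> 1" and V: "pverts G \<noteq> {}" and \<delta>: "1 \<le> min_degree G"
    and m: "real (card (parcs G)) \<le> m"
  defines "n \<equiv> real (card (pverts G))" and "d \<equiv> real (min_degree G)"
  defines "c \<equiv> d + \<alpha> * n - \<alpha> * d - 1"
  shows "alpha_spectral_radius \<alpha> G \<le> (c + sqrt (c\<^sup>2 + 4 * (1 - \<alpha>) * (m - n * d + d))) / 2"
proof -
  define vs where "vs = (SOME vs. distinct vs \<and> set vs = pverts G)"
  have "\<exists>vs. distinct vs \<and> set vs = pverts G"
    using finite_distinct_list[OF pair_finite_verts] by blast
  then have vs: "distinct vs" "set vs = pverts G"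
    unfolding vs_def by (rule someI2_ex, simp)+
  let ?A = "A_alpha \<alpha> G vs" and ?d = "\<lambda>p. real (out_degree (with_proj G) p)"
  define R where "R = (1 - \<alpha>) * (m - n * d + d)"
  define \<mu> where "\<mu> = alpha_spectral_radius \<alpha> G"
  note A = A_alpha_carrier[of \<alpha> vs]
  have len: "length vs > 0" using vs(2) V by auto
  have "spectrum ?A \<noteq> {}"
    using vs parcs_symD by (intro spectrum_real_symmetric_nonempty[OF A len]) (auto simp: A_alpha_entry)
  then have "\<mu> \<in> spectrum ?A"
    unfolding \<mu>_def alpha_spectral_radius_def vs_def[symmetric]
    by (intro Max_in card_finite_spectrum(1)[OF A])
  then have ev: "eigenvalue ?A \<mu>" by (simp add: spectrum_def)
  have d1: "d \<ge> 1" using \<delta> by (simp add: d_def)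
  obtain z where "z \<in> pverts G" "out_degree (with_proj G) z = min_degree G"
    using min_degree_attained[OF V] .
  then have "d < n" using out_degree_less[of z] by (simp add: d_def n_def)
  \<comment> \<open>This expression equals \<open>c\<close>, split into two terms that are visibly
    nonnegative.\<close>
  then have "0 \<le> (1 - \<alpha>) * (d - 1) + \<alpha> * (n - 1)" using \<alpha> d1 by simp
  then have c0: "0 \<le> c" by (simp add: c_def algebra_simps)
  have "n * d \<le> real (card (parcs G))"
    unfolding n_def d_def of_nat_mult[symmetric] of_nat_le_iff by (rule min_degree_mult_le_card_parcs)
  then have R0: "0 \<le> R" unfolding R_def using \<alpha> d1 m by simp
  have sqrt: "c \<le> sqrt (c\<^sup>2 + 4 * R)" using R0 c0 by (intro real_le_rsqrt) auto
  have "\<mu> \<le> (c + sqrt (c\<^sup>2 + 4 * R)) / 2"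
  \<comment> \<open>Below \<open>c\<close> the bound is immediate, as the square root is at least
    \<open>c\<close>; above it the column sum estimate applies.\<close>
  proof (cases "\<mu> \<le> c")
    case True
    then show ?thesis using sqrt by simp
  next
    case False
    have r: "(\<Sum>i<length vs. ?A $$ (i, j)) = ?d (vs ! j)" if j: "j < length vs" for j
      using sum_weighted_A_alpha_column[OF vs j, of "\<lambda>_. 1" \<alpha>]
      by (simp add: out_degree_eq_card_Image algebra_simps)
    have "\<mu>\<^sup>2 \<le> c * \<mu> + R"
    proof (rule eigenvalue_le_of_column_sums[OF A _ r _ ev])
      show "0 \<le> ?A $$ (i, j)" if "i < length vs" "j < length vs" for i j
        unfolding A_alpha_entry[OF vs(1) that] using \<alpha> by simp
    next
      fix j assume j: "j < length vs"
      let ?q = "vs ! j"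
      have q: "?q \<in> pverts G" using nth_mem[OF j] vs(2) by simp
      have dq: "?d ?q \<le> n - 1" using out_degree_less[OF q] by (simp add: n_def)
      have nbrs: "(\<Sum>p\<in>parcs G `` {?q}. ?d p) \<le> m - ?d ?q - (n - 1 - ?d ?q) * d"
        using sum_neighbour_degrees_le[OF q] m unfolding n_def d_def by linarith
      have "(\<Sum>i<length vs. ?d (vs ! i) * ?A $$ (i, j)) =
          \<alpha> * ?d ?q * ?d ?q + (1 - \<alpha>) * (\<Sum>p\<in>parcs G `` {?q}. ?d p)"
        by (rule sum_weighted_A_alpha_column[OF vs j])
      \<comment> \<open>Only one of the two factors \<open>?d ?q\<close> is replaced by
        \<open>n - 1\<close>, so the bound stays linear in the degree; its slope is exactly
        \<open>c\<close>.\<close>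
      also have "\<dots> \<le> \<alpha> * ?d ?q * (n - 1) + (1 - \<alpha>) * (m - ?d ?q - (n - 1 - ?d ?q) * d)"
        using \<alpha> by (intro add_mono mult_left_mono dq nbrs) simp_all
      also have "\<dots> = c * ?d ?q + R" by (simp add: c_def R_def algebra_simps)
      finally show "(\<Sum>i<length vs. ?d (vs ! i) * ?A $$ (i, j)) \<le> c * ?d ?q + R" .
    qed (use False c0 in auto)
    then have "(2 * \<mu> - c)\<^sup>2 \<le> c\<^sup>2 + 4 * R" by (simp add: power2_eq_square algebra_simps)
    then have "2 * \<mu> - c \<le> sqrt (c\<^sup>2 + 4 * R)" by (rule real_le_rsqrt)
    then show ?thesis by simp
  qed
  then show ?thesis unfolding \<mu>_def R_def mult.assoc .
qed

section \<open>Paths of the graph as legs of spiders\<close>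

lemma vpath_with_proj_iff:
  assumes "L \<noteq> []" "set L \<subseteq> pverts G"
  shows "vpath L (with_proj G) \<longleftrightarrow> distinct L \<and> successively (\<lambda>a b. (a, b) \<in> parcs G) L"
proof -
  have "set (vwalk_arcs L) \<subseteq> parcs G \<longleftrightarrow> successively (\<lambda>a b. (a, b) \<in> parcs G) L"
    by (induction L rule: induct_list012) auto
  then show ?thesis using assms by (auto simp: vpath_def vwalk_def)
qed

end

lemma (in pair_graph) coverable_if_spanning_spiders:
  assumes "\<And>u S. u \<in> pverts G \<Longrightarrow> S \<subseteq> pverts G - {u} \<Longrightarrow> card S = t \<Longrightarrow>
      \<exists>P. spanning_spider (pverts G) (parcs G) u S P"
  shows "one_to_many_disjoint_path_coverable t G"
  unfolding one_to_many_disjoint_path_coverable_def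
proof (intro ballI allI impI)
  fix u S assume "u \<in> pverts G" "S \<subseteq> pverts G - {u} \<and> card S = t"
  then obtain P where P: "spanning_spider (pverts G) (parcs G) u S P" using assms by blast
  show "\<exists>P. (\<forall>v\<in>S. vpath (P v) (with_proj G) \<and> hd (P v) = u \<and> last (P v) = v) \<and>
      (\<forall>w\<in>pverts G. \<exists>v\<in>S. w \<in> set (P v)) \<and>
      (\<forall>v\<in>S. \<forall>v'\<in>S. v \<noteq> v' \<longrightarrow> set (P v) \<inter> set (P v') \<subseteq> {u})"
  proof (intro exI[of _ P] conjI ballI impI)
    fix v assume v: "v \<in> S"
    show "hd (P v) = u" "last (P v) = v" using spanning_spiderD[OF P v] by simp_all
    show "vpath (P v) (with_proj G)"
      using spanning_spiderD[OF P v] vpath_with_proj_iff[of "P v"] by simp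
  next
    fix w assume "w \<in> pverts G"
    then show "\<exists>v\<in>S. w \<in> set (P v)" using spanning_spider_cover[OF P] by blast
  next
    fix v v' assume "v \<in> S" "v' \<in> S" "v \<noteq> v'"
    then show "set (P v) \<inter> set (P v') \<subseteq> {u}" by (rule spanning_spider_disjoint[OF P])
  qed
qed

section \<open>Combination of the edge bound with the eigenvalue bound\<close>

theorem corollary2p8:
  fixes n t \<delta> h\<^sub>1 :: nat and \<alpha> :: real and G :: "'a pair_pre_digraph"
  assumes "n \<ge> 3"
    and "3 \<le> t + 1" and "t + 1 \<le> \<delta>" and "\<delta> \<le> (n + t - 2) div 2"
    and "0 \<le> \<alpha>" and "\<alpha> < 1"
    and "h\<^sub>1 = max (edge_bound_f n t \<delta>) (edge_bound_g n t \<delta>)"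
    and "pair_graph G" and "Digraph_Component.connected (with_proj G)"
    and "card (pverts G) = n" and "min_degree G = \<delta>"
    and "alpha_spectral_radius \<alpha> G >
      (real \<delta> + \<alpha> * real n - \<alpha> * real \<delta> - 1
        + sqrt ((real \<delta> + \<alpha> * real n - \<alpha> * real \<delta> - 1)\<^sup>2
            + 4 * (1 - \<alpha>) * (2 * real h\<^sub>1 - real n * real \<delta> + real \<delta>))) / 2"
  shows "one_to_many_disjoint_path_coverable t G"
proof -
  interpret pair_graph G by fact
  have ne: "pverts G \<noteq> {}" using assms(1,10) by auto
  obtain z where z: "z \<in> pverts G" "out_degree (with_proj G) z = \<delta>"
    using min_degree_attained[OF ne] assms(11) by auto
  have sym: "sym (parcs G)" "irrefl (parcs G)" "parcs G \<subseteq> pverts G \<times> pverts G"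
    using parcs_symD Image_parcs(3) in_arcsD1 in_arcsD2 by (auto simp: sym_def irrefl_def)
  show ?thesis
  proof (rule coverable_if_spanning_spiders, rule ccontr)
    fix u S assume *: "u \<in> pverts G" "S \<subseteq> pverts G - {u}" "card S = t"
      and "\<nexists>P. spanning_spider (pverts G) (parcs G) u S P"
    then have none: "\<And>P. \<not> spanning_spider (pverts G) (parcs G) u S P" by blast
    \<comment> \<open>In terms of edges, a missing spider forces at most \<open>h\<^sub>1\<close> of
      them. The eigenvalue bound with \<open>m = 2 * h\<^sub>1\<close> then contradicts the strict
      inequality assumed for the spectral radius.\<close>
    have "card (parcs G) \<le> 2 * h\<^sub>1"
      unfolding assms(7)
    proof (rule spider_free_edge_bound[OF sym pair_finite_verts assms(10) _ z(1) _ _ assms(3) * none])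
      show "\<delta> \<le> card (parcs G `` {v})" if "v \<in> pverts G" for v
        using min_degree_le[OF that] assms(11) by (simp add: out_degree_eq_card_Image)
      show "card (parcs G `` {z}) = \<delta>" using z(2) by (simp add: out_degree_eq_card_Image)
      show "2 \<le> t" using assms(2) by simp
    qed
    then have "real (card (parcs G)) \<le> 2 * real h\<^sub>1" by linarith
    from alpha_spectral_radius_le[OF assms(5) less_imp_le[OF assms(6)] ne _ this] assms(2,3)
    show False using assms(12) unfolding assms(10,11) by simp
  qed
qed

end
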